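(* The set $$\mathcal{Q}=\bigl\{(A,B)\in\mathcal{C}\times\mathcal{C} : A\le_{\mathrm{icx}} B \text{ or } B\le_{\mathrm{icx}} A\bigr\}$$ is nowhere dense in $(\mathcal{C}\times\mathcal{C},d\times d)$. Consequently, its complement $\mathcal{Q}^{c}=(\mathcal{C}\times\mathcal{C})\setminus\mathcal{Q}$ is co-meager in $(\mathcal{C}\times\mathcal{C},d\times d)$.
   Context: A (bivariate) copula is a function $C:[0,1]^2\to[0,1]$ such that $C(t,0)=C(0,t)=0$ and $C(t,1)=C(1,t)=t$ for all $t\in[0,1]$, and $C(u',v')-C(u,v')-C(u',v)+C(u,v)\ge 0$ whenever $u\le u'$, $v\le v'$ in $[0,1]$. Equivalently, $C$ is the restriction to $[0,1]^2$ of the distribution function of a Borel probability measure on $[0,1]^2$ with both marginals uniform on $[0,1]$; $\int_{[0,1]^2}\varphi\,{\rm d}C$ denotes the integral of $\varphi$ with respect to this measure. $\mathcal{C}$ is the set of all copulas, with the uniform metric $d(A,B)=\sup_{(x,y)\in[0,1]^2}|A(x,y)-B(x,y)|$. The product $\mathcal{C}\times\mathcal{C}$ carries the metric $(d\times d)((A,B),(A',B'))=\max\{d(A,A'),d(B,B')\}$. Let $\Phi_{\mathrm{icx}}$ be the set of all finite-valued functions $\varphi:[0,1]^2\to\mathbb{R}$ that are increasing (non-decreasing in each argument) and convex on $[0,1]^2$ (jointly, in the usual sense). For $A,B\in\mathcal{C}$, $A\le_{\mathrm{icx}}B$ (increasing convex order) means $\int_{[0,1]^2}\varphi\,{\rm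 d}A\le\int_{[0,1]^2}\varphi\,{\rm d}B$ for every $\varphi\in\Phi_{\mathrm{icx}}$. A set is nowhere dense if its closure has empty interior, meager if it is a countable union of nowhere dense sets, and co-meager if its complement is meager. *)

theory Defs
  imports "HOL-Probability.Probability"
begin

definition unit_square :: "(real \<times> real) set" where
  "unit_square = {0..1} \<times> {0..1}"

text \<open>Functions on the unit square are represented extensionally (they are \<open>undefined\<close> outside it),
  so that equality of copulas is equality on the unit square.\<close>

definition copulas :: "(real \<times> real \<Rightarrow> real) set" where
  "copulas = {C \<in> unit_square \<rightarrow>\<^sub>E {0..1}.
     (\<forall>t\<in>{0..1}. C (t, 0) = 0 \<and> C (0, t) = 0 \<and> C (t, 1) = t \<and> C (1, t) = t) \<and>
     (\<forall>u\<in>{0..1}. \<forall>u'\<in>{0..1}. \<forall>v\<in>{0..1}. \<forall>v'\<in>{0..1}. u \<le> u' \<longrightarrow> v \<le> v' \<longrightarrow>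
        C (u', v') - C (u, v') - C (u', v) + C (u, v) \<ge> 0)}"

text \<open>The library's locale for metric spaces wants nonnegativity and symmetry of the distance on the
  whole type, whence the default value \<open>0\<close> outside the carrier.\<close>

definition copula_dist :: "(real \<times> real \<Rightarrow> real) \<Rightarrow> (real \<times> real \<Rightarrow> real) \<Rightarrow> real" where
  "copula_dist A B =
     (if A \<in> copulas \<and> B \<in> copulas then (SUP p\<in>unit_square. \<bar>A p - B p\<bar>) else 0)"

definition copula_pair_dist ::
  "(real \<times> real \<Rightarrow> real) \<times> (real \<times> real \<Rightarrow> real) \<Rightarrow>
   (real \<times> real \<Rightarrow> real) \<times> (real \<times> real \<Rightarrow> real) \<Rightarrow> real" where
  "copula_pair_dist = (\<lambda>(A, B) (A', B'). max (copula_dist A A') (copula_dist B B'))"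

lemma copula_dist_upper:
  assumes "A \<in> copulas" "B \<in> copulas" "p \<in> unit_square"
  shows "\<bar>A p - B p\<bar> \<le> copula_dist A B"
proof -
  have "bdd_above ((\<lambda>p. \<bar>A p - B p\<bar>) ` unit_square)"
  proof (rule bdd_aboveI2)
    fix q assume "q \<in> unit_square"
    then have "A q \<in> {0..1}" "B q \<in> {0..1}"
      using assms unfolding copulas_def by blast+
    then show "\<bar>A q - B q\<bar> \<le> 1" by auto
  qed
  then show ?thesis
    using assms by (auto simp: copula_dist_def intro: cSUP_upper)
qed

lemma copula_dist_least:
  assumes "A \<in> copulas" "B \<in> copulas" "\<And>p. p \<in> unit_square \<Longrightarrow> \<bar>A p - B p\<bar> \<le> c"
  shows "copula_dist A B \<le> c"
proof -
  have "unit_square \<noteq> {}" by (auto simp: unit_square_def)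
  then show ?thesis using assms by (auto simp: copula_dist_def intro: cSUP_least)
qed

lemma Metric_space_copulas: "Metric_space copulas copula_dist"
proof
  have sq: "(0, 0) \<in> unit_square" by (auto simp: unit_square_def)
  show "0 \<le> copula_dist A B" for A B
    using copula_dist_upper[OF _ _ sq, of A B] by (cases "A \<in> copulas \<and> B \<in> copulas")
      (auto simp: copula_dist_def)
  show "copula_dist A B = copula_dist B A" for A B
    by (auto simp: copula_dist_def abs_minus_commute)
  show "copula_dist A B = 0 \<longleftrightarrow> A = B" if AB: "A \<in> copulas" "B \<in> copulas" for A B
  proof
    assume 0: "copula_dist A B = 0"
    show "A = B"
    proof (rule PiE_ext)
      show "A \<in> unit_square \<rightarrow>\<^sub>E {0..1}" "B \<in> unit_square \<rightarrow>\<^sub>E {0..1}"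
        using AB by (auto simp: copulas_def)
      show "A p = B p" if "p \<in> unit_square" for p
        using copula_dist_upper[OF AB that] 0 by simp
    qed
  next
    assume "A = B"
    moreover have "unit_square \<noteq> {}" by (auto simp: unit_square_def)
    ultimately show "copula_dist A B = 0" by (simp add: copula_dist_def)
  qed
  show "copula_dist A C \<le> copula_dist A B + copula_dist B C"
    if "A \<in> copulas" "B \<in> copulas" "C \<in> copulas" for A B C
  proof (rule copula_dist_least)
    fix p assume "p \<in> unit_square"
    then show "\<bar>A p - C p\<bar> \<le> copula_dist A B + copula_dist B C"
      using copula_dist_upper[of A B p] copula_dist_upper[of B C p] that by linarith
  qed (use that in auto)
qed

lemma Metric_space_copula_pairs: "Metric_space (copulas \<times> copulas) copula_pair_dist"
proof -
  interpret Metric_space copulas copula_dist by (rule Metric_space_copulas)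
  show ?thesis
  proof
    fix x y z
    show "0 \<le> copula_pair_dist x y"
      by (auto simp: copula_pair_dist_def split: prod.split intro: max.coboundedI1)
    show "copula_pair_dist x y = copula_pair_dist y x"
      by (auto simp: copula_pair_dist_def commute split: prod.split)
    show "copula_pair_dist x y = 0 \<longleftrightarrow> x = y"
      if "x \<in> copulas \<times> copulas" "y \<in> copulas \<times> copulas"
    proof -
      have "max (copula_dist a b) (copula_dist c d) = 0 \<longleftrightarrow> copula_dist a b = 0 \<and> copula_dist c d = 0"
        for a b c d
        using nonneg[of a b] nonneg[of c d] by linarith
      then show ?thesis using that by (auto simp: copula_pair_dist_def)
    qed
    show "copula_pair_dist x z \<le> copula_pair_dist x y + copula_pair_dist y z"
      if "x \<in> copulas \<times> copulas" "y \<in> copulas \<times> copulas" "z \<in> copulas \<times> copulas"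
    proof -
      have "copula_dist (fst x) (fst z) \<le> copula_dist (fst x) (fst y) + copula_dist (fst y) (fst z)"
        "copula_dist (snd x) (snd z) \<le> copula_dist (snd x) (snd y) + copula_dist (snd y) (snd z)"
        using that by (auto intro!: triangle)
      then show ?thesis by (auto simp: copula_pair_dist_def split: prod.split)
    qed
  qed
qed

abbreviation copula_pair_topology ::
  "((real \<times> real \<Rightarrow> real) \<times> (real \<times> real \<Rightarrow> real)) topology" where
  "copula_pair_topology \<equiv> Metric_space.mtopology (copulas \<times> copulas) copula_pair_dist"

text \<open>The rectangles with lower left corner at the origin generate the Borel sets of the unit square
  and are closed under intersection, so at most one measure has the given distribution function;
  for a copula there is one.\<close>

definition copula_measure :: "(real \<times> real \<Rightarrow> real) \<Rightarrow> (real \<times> real) measure" where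
  "copula_measure C = (THE M. prob_space M \<and> sets M = sets (restrict_space borel unit_square) \<and>
     (\<forall>x\<in>{0..1}. \<forall>y\<in>{0..1}. measure M ({0..x} \<times> {0..y}) = C (x, y)))"

text \<open>Only the values on the unit square matter here: the functions are not taken to be extensional,
  and \<^term>\<open>copula_measure C\<close> lives on the unit square. Functions in this class are bounded and
  Borel measurable on the unit square, so their integrals below exist.\<close>

definition icx_functions :: "(real \<times> real \<Rightarrow> real) set" where
  "icx_functions = {\<phi>. convex_on unit_square \<phi> \<and>
     (\<forall>y\<in>{0..1}. mono_on {0..1} (\<lambda>x. \<phi> (x, y))) \<and>
     (\<forall>x\<in>{0..1}. mono_on {0..1} (\<lambda>y. \<phi> (x, y)))}"

definition icx_le :: "(real \<times> real \<Rightarrow> real) \<Rightarrow> (real \<times> real \<Rightarrow> real) \<Rightarrow> bool" where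
  "icx_le A B \<longleftrightarrow> (\<forall>\<phi>\<in>icx_functions.
     (\<integral>p. \<phi> p \<partial>copula_measure A) \<le> (\<integral>p. \<phi> p \<partial>copula_measure B))"

definition icx_comparable_pairs ::
  "((real \<times> real \<Rightarrow> real) \<times> (real \<times> real \<Rightarrow> real)) set" where
  "icx_comparable_pairs = {(A, B) \<in> copulas \<times> copulas. icx_le A B \<or> icx_le B A}"

definition nowhere_dense_in :: "'a topology \<Rightarrow> 'a set \<Rightarrow> bool" where
  "nowhere_dense_in X S \<longleftrightarrow> S \<subseteq> topspace X \<and> X interior_of (X closure_of S) = {}"

definition meager_in :: "'a topology \<Rightarrow> 'a set \<Rightarrow> bool" where
  "meager_in X S \<longleftrightarrow> (\<exists>\<F>. countable \<F> \<and> (\<forall>T\<in>\<F>. nowhere_dense_in X T) \<and> S = \<Union>\<F>)"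

definition comeager_in :: "'a topology \<Rightarrow> 'a set \<Rightarrow> bool" where
  "comeager_in X S \<longleftrightarrow> S \<subseteq> topspace X \<and> meager_in X (topspace X - S)"

end

theory Submission
  imports Defs
begin

text \<open>Put \<open>a = 1 - \<eta>\<close>. For every copula \<open>C\<close>, Fubini's theorem gives
  \<open>\<integral> max 0 (x + y - 1 - a) dC = \<integral>\<^sub>a\<^sup>1 (C (t, 1 + a - t) - a) dt\<close> and
  \<open>\<integral> max 0 (max x y - a) dC = \<integral>\<^sub>a\<^sup>1 (1 - C (t, t)) dt\<close>.
  Both integrands on the left are increasing and convex; the first integral increases with \<open>C\<close>, the
  second decreases, and both are continuous in the uniform metric. Squeezing \<open>A\<close> into \<open>[0, a]\<^sup>2\<close> and
  adding comonotone mass on \<open>[a, 1]\<^sup>2\<close>, and doing the same to \<open>B\<close> with countermonotone mass, moves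
  both copulas by at most \<open>4 \<eta>\<close>. The new pair differs by \<open>min (t - a) (1 - t)\<close> in both integrands on
  the right, with opposite effects on the two integrals, so it is incomparable, and by continuity so
  is every pair in a neighbourhood of it.\<close>

section \<open>Elementary inequalities and continuity of copulas\<close>

lemma copulaD:
  assumes "C \<in> copulas" "t \<in> {0..1}"
  shows "C (t, 0) = 0" "C (0, t) = 0" "C (t, 1) = t" "C (1, t) = t"
  using assms unfolding copulas_def by blast+

lemma copula_rectangle:
  assumes "C \<in> copulas" "u \<in> {0..1}" "u' \<in> {0..1}" "v \<in> {0..1}" "v' \<in> {0..1}" "u \<le> u'" "v \<le> v'"
  shows "C (u', v') - C (u, v') - C (u', v) + C (u, v) \<ge> 0"
  using assms unfolding copulas_def by blast

lemma copula_range: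
  assumes "C \<in> copulas" "u \<in> {0..1}" "v \<in> {0..1}"
  shows "C (u, v) \<in> {0..1}"
proof -
  have "C \<in> unit_square \<rightarrow>\<^sub>E {0..1}" using assms(1) by (simp add: copulas_def)
  moreover have "(u, v) \<in> unit_square" using assms by (simp add: unit_square_def)
  ultimately show ?thesis by (rule PiE_mem)
qed

text \<open>The range condition follows from the others: rectangles with lower left corner at the
  origin give nonnegativity, and monotonicity in the first argument bounds \<open>C (x, y)\<close>
  by \<open>C (1, y) = y\<close>.\<close>

lemma copulaI:
  assumes "C \<in> extensional unit_square"
    and "\<And>t. t \<in> {0..1} \<Longrightarrow> C (t, 0) = 0" "\<And>t. t \<in> {0..1} \<Longrightarrow> C (0, t) = 0"
    and "\<And>t. t \<in> {0..1} \<Longrightarrow> C (t, 1) = t" "\<And>t. t \<in> {0..1} \<Longrightarrow> C (1, t) = t"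
    and rect: "\<And>u u' v v'. \<lbrakk>0 \<le> u; u \<le> u'; u' \<le> 1; 0 \<le> v; v \<le> v'; v' \<le> 1\<rbrakk>
      \<Longrightarrow> C (u', v') - C (u, v') - C (u', v) + C (u, v) \<ge> 0"
  shows "C \<in> copulas"
proof -
  have "C p \<in> {0..1}" if p: "p \<in> unit_square" for p
  proof -
    obtain x y where xy: "p = (x, y)" "x \<in> {0..1}" "y \<in> {0..1}"
      using p unfolding unit_square_def by blast
    have "C (x, y) \<ge> 0" using rect[of 0 x 0 y] assms(2)[of x] assms(3)[of y] assms(3)[of 0] xy by auto
    moreover have "C (x, y) \<le> C (1, y)"
      using rect[of x 1 0 y] assms(2)[of x] assms(2)[of 1] xy by auto
    ultimately show ?thesis using assms(5)[of y] xy by auto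
  qed
  then have "C \<in> unit_square \<rightarrow>\<^sub>E {0..1}" using assms(1) by (auto simp: PiE_iff)
  then show ?thesis using assms(2-) by (simp add: copulas_def)
qed

text \<open>The rectangle inequality is applied to the two pieces into which the height
  \<open>v\<close> cuts the strip over \<open>{u..u'}\<close>: the lower piece gives monotonicity,
  the upper one the Lipschitz bound, because the margin at height 1 is the identity.\<close>

lemma copula_increment_fst:
  assumes "C \<in> copulas" "0 \<le> u" "u \<le> u'" "u' \<le> 1" "v \<in> {0..1}"
  shows "0 \<le> C (u', v) - C (u, v)" "C (u', v) - C (u, v) \<le> u' - u"
  using copula_rectangle[OF assms(1), of u u' 0 v] copula_rectangle[OF assms(1), of u u' v 1]
    copulaD[OF assms(1), of u] copulaD[OF assms(1), of u'] assms by auto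

lemma copula_increment_snd:
  assumes "C \<in> copulas" "0 \<le> v" "v \<le> v'" "v' \<le> 1" "u \<in> {0..1}"
  shows "0 \<le> C (u, v') - C (u, v)" "C (u, v') - C (u, v) \<le> v' - v"
  using copula_rectangle[OF assms(1), of 0 u v v'] copula_rectangle[OF assms(1), of u 1 v v']
    copulaD[OF assms(1), of v] copulaD[OF assms(1), of v'] assms by auto

lemma copula_Lipschitz:
  assumes C: "C \<in> copulas" and "u \<in> {0..1}" "u' \<in> {0..1}" "v \<in> {0..1}" "v' \<in> {0..1}"
  shows "\<bar>C (u', v') - C (u, v)\<bar> \<le> \<bar>u' - u\<bar> + \<bar>v' - v\<bar>"
proof -
  have "\<bar>C (u', v') - C (u, v')\<bar> \<le> \<bar>u' - u\<bar>"
    using copula_increment_fst[OF C, of u u' v'] copula_increment_fst[OF C, of u' u v'] assms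
    by (cases "u \<le> u'") auto
  moreover have "\<bar>C (u, v') - C (u, v)\<bar> \<le> \<bar>v' - v\<bar>"
    using copula_increment_snd[OF C, of v v' u] copula_increment_snd[OF C, of v' v u] assms
    by (cases "v \<le> v'") auto
  ultimately show ?thesis by linarith
qed

lemma continuous_on_copula:
  assumes "C \<in> copulas"
  shows "continuous_on unit_square C"
proof (rule continuous_onI)
  fix p and e :: real assume p: "p \<in> unit_square" and e: "0 < e"
  show "\<exists>d>0. \<forall>p'\<in>unit_square. dist p' p < d \<longrightarrow> dist (C p') (C p) \<le> e"
  proof (intro exI[of _ "e / 2"] conjI ballI impI)
    fix p' assume p': "p' \<in> unit_square" "dist p' p < e / 2"
    have "\<bar>fst p' - fst p\<bar> < e / 2" "\<bar>snd p' - snd p\<bar> < e / 2"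
      using dist_fst_le[of p' p] dist_snd_le[of p' p] p'(2) by (auto simp: dist_real_def)
    moreover have "\<bar>C (fst p', snd p') - C (fst p, snd p)\<bar> \<le> \<bar>fst p' - fst p\<bar> + \<bar>snd p' - snd p\<bar>"
      using p p' by (intro copula_Lipschitz[OF assms]) (auto simp: unit_square_def mem_Times_iff)
    ultimately show "dist (C p') (C p) \<le> e" by (simp add: dist_real_def)
  qed (use e in auto)
qed

section \<open>The measure of a copula\<close>

text \<open>Both sides are measures in \<open>A\<close> that agree on half-open intervals, a
  generator stable under intersection. The consequence used below: if \<open>G - F\<close> is
  increasing, the measure of \<open>F\<close> is at most that of \<open>G\<close>.\<close>

lemma emeasure_interval_measure_add:
  fixes F G :: "real \<Rightarrow> real"
  assumes F: "mono F" "continuous_on UNIV F" and G: "mono G" "continuous_on UNIV G"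
    and A: "A \<in> sets borel"
  shows "emeasure (interval_measure (\<lambda>x. F x + G x)) A =
    emeasure (interval_measure F) A + emeasure (interval_measure G) A"
proof -
  \<comment> \<open>The right-hand side has to be an actual measure before the uniqueness theorem
    for generators can be applied to it.\<close>
  define S where "S = measure_of UNIV (sets borel)
    (\<lambda>A. emeasure (interval_measure F) A + emeasure (interval_measure G) A)"
  have sets_S: "sets S = sets borel" unfolding S_def by (simp add: sets_measure_of_conv)
      (metis sets.sigma_sets_eq space_borel)
  have S: "emeasure S A = emeasure (interval_measure F) A + emeasure (interval_measure G) A"
    if "A \<in> sets borel" for A
  proof (rule emeasure_measure_of[OF S_def])
    show "positive (sets S) (\<lambda>A. emeasure (interval_measure F) A + emeasure (interval_measure G) A)"
      by (auto simp: positive_def)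
    show "countably_additive (sets S) (\<lambda>A. emeasure (interval_measure F) A + emeasure (interval_measure G) A)"
      unfolding sets_S
    proof (rule countably_additiveI)
      fix B :: "nat \<Rightarrow> real set" assume B: "range B \<subseteq> sets borel" "disjoint_family B"
      have "(\<Sum>i. emeasure (interval_measure H) (B i)) = emeasure (interval_measure H) (\<Union>i. B i)" for H
        using B by (intro suminf_emeasure) auto
      then show "(\<Sum>i. emeasure (interval_measure F) (B i) + emeasure (interval_measure G) (B i)) =
          emeasure (interval_measure F) (\<Union>i. B i) + emeasure (interval_measure G) (\<Union>i. B i)"
        by (simp add: suminf_add[symmetric])
    qed
  qed (use that sets_S in auto)
  have rc: "continuous (at_right a) H" if "continuous_on UNIV H" for H :: "real \<Rightarrow> real" and a
    using that by (auto simp: continuous_on_eq_continuous_within intro: continuous_within_subset)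
  have FG: "continuous_on UNIV (\<lambda>x. F x + G x)" using F G by (intro continuous_intros)
  have Ioc: "emeasure (interval_measure H) {a<..b} = (if a \<le> b then ennreal (H b - H a) else 0)"
    if "mono H" "continuous_on UNIV H" for H a b
    using that by (subst emeasure_interval_measure_Ioc_eq) (auto dest: monoD intro: rc)
  have mFG: "mono (\<lambda>x. F x + G x)" using F G by (auto simp: mono_def intro: add_mono)
  have "interval_measure (\<lambda>x. F x + G x) = S"
  proof (rule measure_eqI_generator_eq)
    let ?E = "range (\<lambda>(a, b). {a<..b::real})"
    show "Int_stable ?E" 
    proof (rule Int_stableI)
      fix X Y assume "X \<in> ?E" "Y \<in> ?E"
      then obtain a b c d where "X = {a<..b}" "Y = {c<..d}" by auto
      then show "X \<inter> Y \<in> ?E" by (intro image_eqI[of _ _ "(max a c, min b d)"]) auto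
    qed
    show "?E \<subseteq> Pow UNIV" by auto
    have *: "sets borel = sigma_sets UNIV ?E"
      by (subst borel_sigma_sets_Ioc) auto
    show "sets (interval_measure (\<lambda>x. F x + G x)) = sigma_sets UNIV ?E" using * by simp
    show "sets S = sigma_sets UNIV ?E" using * sets_S by simp
    show "emeasure (interval_measure (\<lambda>x. F x + G x)) X = emeasure S X" if "X \<in> ?E" for X
      using that F G
      by (auto simp: S Ioc[OF mFG FG] Ioc[OF F] Ioc[OF G] mono_def ennreal_plus[symmetric] simp del: ennreal_plus intro!: arg_cong[where f=ennreal])
    show "range (\<lambda>i. {- real i<..real i}) \<subseteq> ?E" by auto
    show "(\<Union>i. {- real i<..real i}) = UNIV"
    proof -
      have "\<exists>i. - real i < x \<and> x \<le> real i" for x :: real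
      proof -
        obtain i where "\<bar>x\<bar> < real i" using reals_Archimedean2 by blast
        then show ?thesis by (intro exI[of _ i]) auto
      qed
      then show ?thesis by auto
    qed
    show "emeasure (interval_measure (\<lambda>x. F x + G x)) {- real i<..real i} \<noteq> \<infinity>" for i
      by (simp add: Ioc[OF mFG FG])
  qed
  then show ?thesis using S[OF A] by simp
qed

text \<open>The measure of \<open>F\<close> is dominated by that of \<open>G\<close>, which has a
  density and so vanishes on Lebesgue null sets. Hence the Radon-Nikodym theorem applies to
  \<open>F\<close> as well.\<close>

lemma interval_measure_density_exists:
  fixes F :: "real \<Rightarrow> real"
  assumes F: "mono F" "continuous_on UNIV F" and G: "mono G" "continuous_on UNIV G"
    and mono: "mono (\<lambda>x. G x - F x)" and g: "g \<in> borel_measurable lborel" "density lborel g = interval_measure G"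
  shows "\<exists>f \<in> borel_measurable lborel. density lborel f = interval_measure F"
proof (rule sigma_finite_measure.Radon_Nikodym)
  show "sigma_finite_measure lborel" by (rule sigma_finite_lborel)
  have cont: "continuous_on UNIV (\<lambda>x. G x - F x)" using F G by (intro continuous_intros)
  have le: "emeasure (interval_measure F) A \<le> emeasure (interval_measure G) A" if "A \<in> sets borel" for A
    using emeasure_interval_measure_add[OF F mono cont that] by simp
  have ac: "absolutely_continuous lborel (interval_measure G)"
    unfolding g(2)[symmetric] using g(1) by (rule absolutely_continuousI_density)
  show "absolutely_continuous lborel (interval_measure F)"
    unfolding absolutely_continuous_def
  proof
    fix N :: "real set" assume "N \<in> null_sets lborel"
    then have "N \<in> null_sets (interval_measure G)" using ac by (auto simp: absolutely_continuous_def)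
    then have N: "N \<in> sets borel" "emeasure (interval_measure G) N = 0" by (simp_all add: null_sets_def)
    then have "emeasure (interval_measure F) N = 0" using le[OF N(1)] by simp
    with N show "N \<in> null_sets (interval_measure F)" by (simp add: null_sets_def)
  qed
qed auto

text \<open>The increasing function \<open>G - F\<close> has a density \<open>h\<close> too. Then
  \<open>f + h\<close> and \<open>g\<close> are densities of the same measure, so they agree almost
  everywhere, and \<open>h\<close> is nonnegative.\<close>

lemma interval_measure_density_le:
  fixes F :: "real \<Rightarrow> real"
  assumes F: "mono F" "continuous_on UNIV F" and G: "mono G" "continuous_on UNIV G"
    and mono: "mono (\<lambda>x. G x - F x)"
    and f: "f \<in> borel_measurable lborel" "density lborel f = interval_measure F"
    and g: "g \<in> borel_measurable lborel" "density lborel g = interval_measure G"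
  shows "AE x in lborel. f x \<le> g x"
proof -
  have cont: "continuous_on UNIV (\<lambda>x. G x - F x)" using F G by (intro continuous_intros)
  \<comment> \<open>The existence lemma is used with \<open>G - F\<close> in the role of
    \<open>F\<close>; what remains of \<open>G\<close> is then \<open>F\<close> itself.\<close>
  have "mono (\<lambda>x. G x - (G x - F x))" using F by simp
  from interval_measure_density_exists[OF mono cont G this g]
  obtain h where h: "h \<in> borel_measurable lborel" "density lborel h = interval_measure (\<lambda>x. G x - F x)"
    by auto
  have "AE x in lborel. g x = f x + h x"
  proof (rule sigma_finite_measure.density_unique[OF sigma_finite_lborel])
    show "density lborel g = density lborel (\<lambda>x. f x + h x)"
    proof (rule measure_eqI)
      fix A assume "A \<in> sets (density lborel g)"
      then have A: "A \<in> sets borel" by simp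
      have "emeasure (density lborel (\<lambda>x. f x + h x)) A = emeasure (density lborel f) A + emeasure (density lborel h) A"
        using A f(1) h(1) by (simp add: emeasure_density distrib_right nn_integral_add)
      also have "\<dots> = emeasure (density lborel g) A"
        unfolding f(2) h(2) g(2) using emeasure_interval_measure_add[OF F mono cont A] by simp
      finally show "emeasure (density lborel g) A = emeasure (density lborel (\<lambda>x. f x + h x)) A" by simp
    qed simp
  qed (use f g h in auto)
  then show ?thesis by eventually_elim simp
qed

text \<open>The function \<open>g q\<close> is a version of the partial derivative of
  \<open>C\<close> in its first argument at height \<open>q\<close>. Each slice is increasing and
  1-Lipschitz, which yields a density; the rectangle inequality makes densities increase with
  \<open>q\<close>, at first only almost everywhere. With rational \<open>q\<close>, countably many
  null sets are involved, and the versions can be corrected so that order and range hold at every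
  \<open>t\<close>.\<close>

lemma copula_slice_density:
  assumes C: "C \<in> copulas"
  obtains g :: "real \<Rightarrow> real \<Rightarrow> real" where
    "\<And>q. q \<in> \<rat> \<inter> {0..1} \<Longrightarrow> g q \<in> borel_measurable borel"
    "\<And>q t. q \<in> \<rat> \<inter> {0..1} \<Longrightarrow> g q t \<in> {0..1}"
    "\<And>q r t. \<lbrakk>q \<in> \<rat> \<inter> {0..1}; r \<in> \<rat> \<inter> {0..1}; q \<le> r\<rbrakk> \<Longrightarrow> g q t \<le> g r t"
    "\<And>q x. \<lbrakk>q \<in> \<rat> \<inter> {0..1}; x \<in> {0..1}\<rbrakk> \<Longrightarrow> (\<integral>\<^sup>+t\<in>{0..x}. ennreal (g q t) \<partial>lborel) = ennreal (C (x, q))"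
proof -
  let ?Q = "\<rat> \<inter> {0..1} :: real set"
  have Q: "countable ?Q" by (intro countable_Int1 countable_rat)
  \<comment> \<open>Interval measures are built from functions on the whole line, so each slice is
    extended by constants outside the unit interval.\<close>
  define clip where "clip t = max 0 (min 1 t)" for t :: real
  have clip: "clip t \<in> {0..1}" for t
    by (auto simp: clip_def)
  have clip_mono: "clip t \<le> clip t'" "clip t' - clip t \<le> t' - t" if "t \<le> t'" for t t'
    using that     by (auto simp: clip_def)
  define F where "F q t = C (clip t, q)" for q t
  have mono_F: "mono (F q)" if "q \<in> {0..1}" for q
    using copula_increment_fst(1)[OF C] clip clip_mono that by (auto simp: mono_def F_def)
  have cont_F: "continuous_on UNIV (F q)" if "q \<in> {0..1}" for q
    unfolding F_def clip_def
    by (rule continuous_on_compose2[OF continuous_on_copula[OF C]])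
      (use that in \<open>auto simp: unit_square_def intro!: continuous_intros\<close>)
  have id: "mono (\<lambda>x::real. x)" "continuous_on UNIV (\<lambda>x::real. x)" by (auto simp: mono_def)
  have mono_id: "mono (\<lambda>t. t - F q t)" if "q \<in> {0..1}" for q
  proof (rule monoI)
    fix t t' :: real assume "t \<le> t'"
    then show "t - F q t \<le> t' - F q t'"
      using copula_increment_fst(2)[OF C, of "clip t" "clip t'" q] clip[of t] clip[of t'] clip_mono[OF \<open>t \<le> t'\<close>] that
      by (auto simp: F_def)
  qed
  have mono_FF: "mono (\<lambda>t. F r t - F q t)" if "q \<in> {0..1}" "r \<in> {0..1}" "q \<le> r" for q r
  proof (rule monoI)
    fix t t' :: real assume "t \<le> t'"
    then show "F r t - F q t \<le> F r t' - F q t'"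
      using copula_rectangle[OF C, of "clip t" "clip t'" q r] clip[of t] clip[of t'] clip_mono[OF \<open>t \<le> t'\<close>] that
      by (auto simp: F_def)
  qed
  \<comment> \<open>Lebesgue measure is the interval measure of the identity, with density 1.
    Comparison with it gives both the existence of the densities and the bound 1.\<close>
  have lb: "(\<lambda>_. 1) \<in> borel_measurable lborel" "density lborel (\<lambda>_. 1) = interval_measure (\<lambda>x. x)"
    by (simp_all add: density_1 lborel_eq_real)
  have "\<exists>f\<in>borel_measurable lborel. density lborel f = interval_measure (F q)" if "q \<in> {0..1}" for q
    using interval_measure_density_exists[OF mono_F[OF that] cont_F[OF that] id mono_id[OF that] lb] .
  then obtain f where f: "\<And>q. q \<in> {0..1} \<Longrightarrow> f q \<in> borel_measurable lborel"
    "\<And>q. q \<in> {0..1} \<Longrightarrow> density lborel (f q) = interval_measure (F q)"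
    by metis
  have f_le: "AE t in lborel. f q t \<le> f r t" if "q \<in> {0..1}" "r \<in> {0..1}" "q \<le> r" for q r
    using that by (intro interval_measure_density_le[OF mono_F cont_F mono_F cont_F mono_FF f f])
  have f_le_1: "AE t in lborel. f q t \<le> 1" if "q \<in> {0..1}" for q
    using that by (intro interval_measure_density_le[OF mono_F cont_F id mono_id f lb])
  \<comment> \<open>The supremum over rationals up to \<open>q\<close> forces monotonicity in
    \<open>q\<close> at every \<open>t\<close>, and the truncation forces the bound 1. Neither
    changes \<open>f q\<close> outside a null set.\<close>
  define h where "h q t = min 1 (SUP r\<in>?Q \<inter> {..q}. f r t)" for q t
  have h_meas: "h q \<in> borel_measurable borel" for q
    unfolding h_def using f(1) Q by (intro borel_measurable_min borel_measurable_SUP) (auto intro: countable_subset)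
  have h_AE: "AE t in lborel. h q t = f q t" if q: "q \<in> ?Q" for q
  proof -
    have "AE t in lborel. \<forall>r\<in>?Q \<inter> {..q}. f r t \<le> f q t"
      using Q q f_le by (subst AE_ball_countable) (auto intro: countable_subset)
    moreover have "AE t in lborel. f q t \<le> 1" using f_le_1 q by auto
    ultimately show ?thesis
    proof eventually_elim
      case (elim t)
      then have "(SUP r\<in>?Q \<inter> {..q}. f r t) = f q t"
        using q by (intro antisym SUP_least SUP_upper) auto
      then show ?case using elim by (simp add: h_def min_absorb2)
    qed
  qed
  have h_le_1: "h q t \<le> 1" for q t by (simp add: h_def)
  have h_fin: "ennreal (enn2real (h q t)) = h q t" for q t
    using h_le_1[of q t] by (intro ennreal_enn2real) (auto simp: less_top[symmetric] top_unique)
  show thesis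
  proof (rule that[of "\<lambda>q t. enn2real (h q t)"])
    show "(\<lambda>t. enn2real (h q t)) \<in> borel_measurable borel" for q
      using h_meas[of q] by measurable
    show "enn2real (h q t) \<in> {0..1}" for q t
      using h_le_1[of q t] by (auto intro: enn2real_leI)
    show "enn2real (h q t) \<le> enn2real (h r t)" if "q \<le> r" for q r t
    proof (rule enn2real_mono)
      show "h q t \<le> h r t"
        unfolding h_def using that by (intro min.mono SUP_subset_mono) auto
      show "h r t < top" using h_le_1[of r t] by (auto simp: less_top[symmetric] top_unique)
    qed
    show "(\<integral>\<^sup>+t\<in>{0..x}. ennreal (enn2real (h q t)) \<partial>lborel) = ennreal (C (x, q))"
      if q: "q \<in> ?Q" and x: "x \<in> {0..1}" for q x
    proof -
      have "(\<integral>\<^sup>+t\<in>{0..x}. ennreal (enn2real (h q t)) \<partial>lborel) = (\<integral>\<^sup>+t\<in>{0..x}. f q t \<partial>lborel)"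
        unfolding h_fin using h_AE[OF q] by (intro nn_integral_cong_AE) (auto elim: eventually_mono)
      also have "\<dots> = emeasure (density lborel (f q)) {0..x}"
        using f(1)[of q] q by (simp add: emeasure_density)
      also have "\<dots> = emeasure (interval_measure (F q)) {0..x}"
        using f(2)[of q] q by simp
      also have "\<dots> = ennreal (F q x - F q 0)"
        using x q mono_F[of q] cont_F[of q] by (intro emeasure_interval_measure_Icc) (auto dest: monoD)
      also have "F q x - F q 0 = C (x, q)"
        using x q copulaD(2)[OF C, of q] by (simp add: F_def clip_def)
      finally show ?thesis .
    qed
  qed
qed

lemma unit_square_borel [measurable]: "unit_square \<in> sets borel"
  unfolding unit_square_def by (intro borel_closed closed_Times) auto

text \<open>The quantile transform: for \<open>(t, v)\<close> uniform on the square, the density \<open>q \<mapsto> g q t\<close> of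
  the slices of \<open>C\<close> serves as the conditional distribution function of the second coordinate given
  that the first is \<open>t\<close>, and \<open>Y (t, v)\<close> is its generalized inverse at \<open>v\<close>. Only rational \<open>q\<close> occur, so
  that countably many null sets have to be discarded.\<close>

lemma copula_measure_exists:
  assumes C: "C \<in> copulas"
  obtains M where "prob_space M" "sets M = sets (restrict_space borel unit_square)"
    "\<And>x y. \<lbrakk>x \<in> {0..1}; y \<in> {0..1}\<rbrakk> \<Longrightarrow> measure M ({0..x} \<times> {0..y}) = C (x, y)"
proof -
  let ?Q = "\<rat> \<inter> {0..1} :: real set"
  have Q: "countable ?Q" by (intro countable_Int1 countable_rat)
  obtain g where g [measurable]: "\<And>q. q \<in> ?Q \<Longrightarrow> g q \<in> borel_measurable borel"
    and g_range: "\<And>q t. q \<in> ?Q \<Longrightarrow> g q t \<in> {0..1}"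
    and g_mono: "\<And>q r t. \<lbrakk>q \<in> ?Q; r \<in> ?Q; q \<le> r\<rbrakk> \<Longrightarrow> g q t \<le> g r t"
    and g_int: "\<And>q x. \<lbrakk>q \<in> ?Q; x \<in> {0..1}\<rbrakk>
      \<Longrightarrow> (\<integral>\<^sup>+t\<in>{0..x}. ennreal (g q t) \<partial>lborel) = ennreal (C (x, q))"
    by (rule copula_slice_density[OF C]) (rule that; assumption)
  \<comment> \<open>The value 1 stands for an unsuccessful \<open>q\<close>: it keeps the index set
    of the infimum fixed, and \<open>Y\<close> equals 1 when no \<open>q\<close> below 1
    succeeds.\<close>
  define Y where "Y p = (INF q\<in>?Q. if snd p \<le> g q (fst p) then q else 1)" for p
  have bdd: "bdd_below ((\<lambda>q. if snd p \<le> g q (fst p) then q else 1) ` ?Q)" for p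
    by (intro bdd_belowI2[of _ 0]) auto
  have Y_meas [measurable]: "Y \<in> borel_measurable (borel \<Otimes>\<^sub>M borel)"
    unfolding Y_def
  proof (rule borel_measurable_cINF[OF Q _ bdd])
    fix q assume q: "q \<in> ?Q"
    note [measurable] = g[OF q]
    show "(\<lambda>p. if snd p \<le> g q (fst p) then q else 1) \<in> borel_measurable (borel \<Otimes>\<^sub>M borel)"
      by measurable
  qed
  have Y_range: "Y p \<in> {0..1}" for p
  proof -
    have "0 \<le> Y p" unfolding Y_def by (intro cINF_greatest) auto
    moreover have "Y p \<le> 1" unfolding Y_def by (rule cINF_lower2[OF bdd, of 1]) auto
    ultimately show ?thesis by simp
  qed
  have Y_le: "Y (t, v) \<le> q" if "q \<in> ?Q" "v \<le> g q t" for q t v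
    unfolding Y_def using that by (intro cINF_lower2[OF bdd, of q]) auto
  have Y_less: "v \<le> g q t" if q: "q \<in> ?Q" "Y (t, v) < q" for q t v
  proof -
    have "1 \<in> ?Q" by simp
    then have "?Q \<noteq> {}" by blast
    then have "\<exists>r\<in>?Q. (if snd (t, v) \<le> g r (fst (t, v)) then r else 1) < q"
      using q(2) unfolding Y_def by (rule cINF_less_iff[OF _ bdd, THEN iffD1])
    then obtain r where r: "r \<in> ?Q" "(if v \<le> g r t then r else 1) < q" by auto
    \<comment> \<open>The default branch would mean \<open>1 < q\<close>, which is excluded by
      \<open>q \<le> 1\<close>.\<close>
    with q(1) have "v \<le> g r t" "r \<le> q" by (auto split: if_splits)
    with g_mono[OF r(1) q(1), of t] show ?thesis by linarith
  qed
  let ?L = "lborel \<Otimes>\<^sub>M lborel :: (real \<times> real) measure"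
  define U where "U = restrict_space ?L unit_square"
  have sq: "unit_square \<in> sets (borel \<Otimes>\<^sub>M borel)" by (auto simp: unit_square_def)
  have U_eq: "emeasure U A = emeasure ?L A" if "A \<subseteq> unit_square" for A
    unfolding U_def using that sq by (intro emeasure_restrict_space) auto
  interpret U: prob_space U
  proof
    have "emeasure ?L unit_square = 1" unfolding unit_square_def by (subst lborel.emeasure_pair_measure_Times) auto
    then show "emeasure U (space U) = 1"
      by (subst U_eq) (auto simp: U_def space_restrict_space space_pair_measure)
  qed
  \<comment> \<open>The region under the graph of \<open>g q\<close> over \<open>{0..x}\<close>. Its
    area is the integral in \<open>g_int\<close>, that is, \<open>C (x, q)\<close>.\<close>
  define S where "S x q = {0..x} \<times> {0..1} \<inter> {p. snd p \<le> g q (fst p)}" for x q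
  have S: "emeasure U (S x q) = ennreal (C (x, q))" if x: "x \<in> {0..1}" and q: "q \<in> ?Q" for x q
  proof -
    note [measurable] = g[OF q]
    have "S x q = {p \<in> space (borel \<Otimes>\<^sub>M borel). fst p \<in> {0..x} \<and> snd p \<in> {0..1} \<and> snd p \<le> g q (fst p)}"
      by (auto simp: S_def space_pair_measure)
    also have "\<dots> \<in> sets (borel \<Otimes>\<^sub>M borel)" by measurable
    finally have "S x q \<in> sets ?L" by simp
    then have "emeasure ?L (S x q) = (\<integral>\<^sup>+t. emeasure lborel (Pair t -` S x q) \<partial>lborel)"
      by (rule lborel.emeasure_pair_measure_alt)
    also have "\<dots> = (\<integral>\<^sup>+t\<in>{0..x}. ennreal (g q t) \<partial>lborel)"
    proof (intro nn_integral_cong)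
      fix t
      have "Pair t -` S x q = (if t \<in> {0..x} then {0..g q t} else {})"
        using g_range[OF q, of t] by (auto simp: S_def)
      then show "emeasure lborel (Pair t -` S x q) = ennreal (g q t) * indicator {0..x} t"
        using g_range[OF q, of t] by simp
    qed
    finally show ?thesis using x q by (subst U_eq) (auto simp: g_int S_def unit_square_def)
  qed
  have S_sets: "S x q \<in> sets U" if "x \<in> {0..1}" "q \<in> ?Q" for x q
  proof -
    note [measurable] = g[OF that(2)]
    have "S x q = unit_square \<inter> {p \<in> space (borel \<Otimes>\<^sub>M borel). fst p \<in> {0..x} \<and> snd p \<in> {0..1} \<and> snd p \<le> g q (fst p)}"
      using that by (auto simp: S_def space_pair_measure unit_square_def)
    then show ?thesis unfolding U_def sets_restrict_space by auto
  qed
  define T where "T p = (fst p, Y p)" for p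
  define M where "M = distr U (restrict_space borel unit_square) T"
  have T: "T \<in> measurable U (restrict_space borel unit_square)"
  proof (rule measurable_restrict_space2)
    show "T \<in> space U \<rightarrow> unit_square"
      using Y_range by (auto simp: T_def U_def space_restrict_space unit_square_def)
    have "T \<in> measurable (borel \<Otimes>\<^sub>M borel) (borel \<Otimes>\<^sub>M borel)" unfolding T_def by measurable
    moreover have "sets ?L = sets (borel \<Otimes>\<^sub>M borel)" by (intro sets_pair_measure_cong) simp_all
    ultimately have "T \<in> measurable ?L borel"
      by (simp only: borel_prod measurable_cong_sets[of ?L "borel \<Otimes>\<^sub>M borel", OF _ refl])
    then show "T \<in> borel_measurable U" unfolding U_def by (rule measurable_restrict_space1)
  qed
  have M_eq: "measure M ({0..x} \<times> {0..y}) = measure U {p \<in> space U. fst p \<le> x \<and> Y p \<le> y}"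
    and V_sets: "{p \<in> space U. fst p \<le> x \<and> Y p \<le> y} \<in> sets U"
    if "x \<in> {0..1}" "y \<in> {0..1}" for x y
  proof -
    have "{0..x} \<times> {0..y} \<in> sets borel" by (intro borel_closed closed_Times) auto
    then have R: "{0..x} \<times> {0..y} \<in> sets (restrict_space borel unit_square)"
      using that by (subst sets_restrict_space_iff) (use unit_square_borel in \<open>auto simp: unit_square_def\<close>)
    have *: "T -` ({0..x} \<times> {0..y}) \<inter> space U = {p \<in> space U. fst p \<le> x \<and> Y p \<le> y}"
      using Y_range by (auto simp: T_def U_def space_restrict_space unit_square_def)
    show "measure M ({0..x} \<times> {0..y}) = measure U {p \<in> space U. fst p \<le> x \<and> Y p \<le> y}"
      unfolding M_def measure_distr[OF T R] * ..
    show "{p \<in> space U. fst p \<le> x \<and> Y p \<le> y} \<in> sets U"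
      using measurable_sets[OF T R] by (simp only: *)
  qed
  have C_M: "measure U (S x q) = C (x, q)" if "x \<in> {0..1}" "q \<in> ?Q" for x q
    using S[OF that] copula_range[OF C that(1), of q] that by (simp add: measure_def)
  show thesis
  proof (rule that[of M])
    show "prob_space M" unfolding M_def using T by (rule U.prob_space_distr)
    show "sets M = sets (restrict_space borel unit_square)" by (simp add: M_def)
    fix x y :: real assume x: "x \<in> {0..1}" and y: "y \<in> {0..1}"
    let ?V = "{p \<in> space U. fst p \<le> x \<and> Y p \<le> y}"
    \<comment> \<open>The event \<open>?V\<close> is squeezed between the regions
      \<open>S x q\<close> for rational \<open>q\<close> below and above \<open>y\<close>. The
      continuity of \<open>C\<close> closes the gap.\<close>
    have lower: "C (x, q) \<le> measure U ?V" if q: "q \<in> ?Q" "q \<le> y" for q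
    proof -
      have "S x q \<subseteq> ?V" 
        using x q Y_le[OF q(1)] by (force simp: S_def U_def space_restrict_space unit_square_def space_pair_measure)
      from U.finite_measure_mono[OF this V_sets[OF x y]] show ?thesis using C_M[OF x q(1)] by simp
    qed
    have upper: "measure U ?V \<le> C (x, q)" if q: "q \<in> ?Q" "y < q" for q
    proof -
      have "?V \<subseteq> S x q" 
        using x q Y_less[OF q(1)] by (force simp: S_def U_def space_restrict_space unit_square_def)
      from U.finite_measure_mono[OF this S_sets[OF x q(1)]] show ?thesis using C_M[OF x q(1)] by simp
    qed
    \<comment> \<open>No element of \<open>?Q\<close> lies below \<open>y = 0\<close>, but there
      \<open>q = 0\<close> itself serves. Otherwise a rational within \<open>e\<close> below
      \<open>y\<close> is taken, and the Lipschitz bound controls the error.\<close>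
    have ge: "C (x, y) \<le> measure U ?V + e" if "e > 0" for e
    proof (cases "y = 0")
      case True
      then show ?thesis using lower[of 0] that by simp
    next
      case False
      with y that have "max 0 (y - e) < y" by auto
      then obtain q where "q \<in> \<rat>" "max 0 (y - e) < q" "q < y" using Rats_dense_in_real by blast
      then show ?thesis using lower[of q] copula_increment_snd(2)[OF C, of q y x] x y by auto
    qed
    \<comment> \<open>No element of \<open>?Q\<close> exceeds \<open>y = 1\<close>; in that case the
      event lies in a strip of area \<open>x = C (x, 1)\<close>.\<close>
    have le: "measure U ?V \<le> C (x, y) + e" if "e > 0" for e
    proof (cases "y = 1")
      case True
      have "{0..x} \<times> {0..1} \<in> sets ?L" by simp
      then have "{0..x} \<times> {0..1} \<in> sets U"
        using x sq unfolding U_def by (subst sets_restrict_space_iff) (auto simp: unit_square_def)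
      then have "measure U ?V \<le> measure U ({0..x} \<times> {0..1})"
        using x by (intro U.finite_measure_mono) (auto simp: U_def space_restrict_space unit_square_def)
      also have "\<dots> = x" 
        using x by (subst measure_def, subst U_eq) (auto simp: unit_square_def lborel.emeasure_pair_measure_Times)
      finally show ?thesis using True copulaD(3)[OF C x] that by simp
    next
      case False
      with y that have "y < min 1 (y + e)" by auto
      then obtain q where "q \<in> \<rat>" "y < q" "q < min 1 (y + e)" using Rats_dense_in_real by blast
      then show ?thesis using upper[of q] copula_increment_snd(2)[OF C, of y q x] x y by auto
    qed
    have "measure U ?V = C (x, y)"
      using field_le_epsilon[OF ge] field_le_epsilon[OF le] by (rule antisym[rotated])
    then show "measure M ({0..x} \<times> {0..y}) = C (x, y)" using M_eq[OF x y] by simp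
  qed
qed

text \<open>Both measures are pushed forward to the plane, where the sets \<open>{..a}\<close> form
  a generator stable under intersection. Their traces on the unit square are rectangles at the
  origin, or empty.\<close>

lemma unit_square_measure_eqI:
  fixes M N :: "(real \<times> real) measure"
  assumes M: "prob_space M" "sets M = sets (restrict_space borel unit_square)"
    and N: "prob_space N" "sets N = sets (restrict_space borel unit_square)"
    and eq: "\<And>x y. \<lbrakk>x \<in> {0..1}; y \<in> {0..1}\<rbrakk> \<Longrightarrow>
      measure M ({0..x} \<times> {0..y}) = measure N ({0..x} \<times> {0..y})"
  shows "M = N"
proof (rule measure_eqI)
  show "sets M = sets N" using M N by simp
  let ?D = "\<lambda>M. distr M borel (\<lambda>p. p)"
  have sp: "space K = unit_square" if "sets K = sets (restrict_space borel unit_square)"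
    for K :: "(real \<times> real) measure"
    using sets_eq_imp_space_eq[OF that] by (simp add: space_restrict_space)
  have meas: "(\<lambda>p. p) \<in> borel_measurable K" if "sets K = sets (restrict_space borel unit_square)"
    for K :: "(real \<times> real) measure"
    using measurable_restrict_space1[of "\<lambda>p. p" borel borel unit_square]
    by (simp add: measurable_cong_sets[OF that refl])
  have "?D M = ?D N"
  proof (rule measure_eqI_generator_eq)
    let ?E = "range (\<lambda>a::real \<times> real. {..a})"
    show "Int_stable ?E"
    proof (rule Int_stableI)
      fix X Y assume "X \<in> ?E" "Y \<in> ?E"
      then obtain a b where "X = {..a}" "Y = {..b}" by auto
      then show "X \<inter> Y \<in> ?E" by (intro image_eqI[of _ _ "inf a b"]) auto
    qed
    have "sets borel = sigma_sets UNIV ?E" by (subst borel_eq_atMost) auto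
    then show "sets (?D M) = sigma_sets UNIV ?E" "sets (?D N) = sigma_sets UNIV ?E" by simp_all
    show "emeasure (?D M) X = emeasure (?D N) X" if XE: "X \<in> ?E" for X
    proof -
      obtain x y where X: "X = {..(x, y)}" using XE by (auto simp: image_iff)
      have XB: "X \<in> sets borel" using X by simp
      have "{..z} \<inter> {0..1} = {0..min z 1}" for z :: real by auto
      moreover have "X = {..x} \<times> {..y}" unfolding X by (auto simp: less_eq_prod_def)
      ultimately have XS: "X \<inter> unit_square = {0..min x 1} \<times> {0..min y 1}"
        by (simp add: unit_square_def Times_Int_Times)
      \<comment> \<open>Coordinates above 1 are capped; a negative coordinate makes the trace
        empty.\<close>
      have "measure M (X \<inter> unit_square) = measure N (X \<inter> unit_square)"
        unfolding XS using eq[of "min x 1" "min y 1"] by (cases "0 \<le> x \<and> 0 \<le> y") auto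
      then have "emeasure M (X \<inter> unit_square) = emeasure N (X \<inter> unit_square)"
        using M(1) N(1) by (simp add: finite_measure.emeasure_eq_measure prob_space.finite_measure)
      then show ?thesis
        using XB by (simp add: emeasure_distr meas M N sp)
    qed
    show "range (\<lambda>i::nat. {..(real i, real i)}) \<subseteq> ?E" by auto
    show "(\<Union>i::nat. {..(real i, real i)}) = UNIV"
    proof -
      have "\<exists>i::nat. p \<le> (real i, real i)" for p :: "real \<times> real"
      proof -
        obtain i where "max (fst p) (snd p) \<le> real i" using real_arch_simple by blast
        then show ?thesis by (intro exI[of _ i]) (auto simp: less_eq_prod_def)
      qed
      then show ?thesis by auto
    qed
    show "emeasure (?D M) {..(real i, real i)} \<noteq> \<infinity>" for i :: nat
      using M by (simp add: emeasure_distr meas finite_measure.emeasure_finite prob_space.finite_measure)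
  qed auto
  then have *: "emeasure (?D M) A = emeasure (?D N) A" for A by simp
  fix A assume "A \<in> sets M"
  then have A: "A \<in> sets borel" "A \<subseteq> unit_square"
    using M by (simp_all add: sets_restrict_space_iff unit_square_borel)
  with *[of A] show "emeasure M A = emeasure N A"
    by (simp add: emeasure_distr meas M N sp Int_absorb2)
qed

lemma copula_measure:
  assumes C: "C \<in> copulas"
  shows "prob_space (copula_measure C)" "sets (copula_measure C) = sets (restrict_space borel unit_square)"
    "\<And>x y. \<lbrakk>x \<in> {0..1}; y \<in> {0..1}\<rbrakk> \<Longrightarrow> measure (copula_measure C) ({0..x} \<times> {0..y}) = C (x, y)"
proof -
  let ?P = "\<lambda>M. prob_space M \<and> sets M = sets (restrict_space borel unit_square) \<and>
     (\<forall>x\<in>{0..1}. \<forall>y\<in>{0..1}. measure M ({0..x} \<times> {0..y}) = C (x, y))"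
  obtain M where "?P M" using copula_measure_exists[OF C] by metis
  moreover have "N = M" if "?P N" for N
    using that \<open>?P M\<close> by (intro unit_square_measure_eqI) auto
  ultimately have "?P (copula_measure C)" unfolding copula_measure_def by (rule theI)
  then show "prob_space (copula_measure C)" "sets (copula_measure C) = sets (restrict_space borel unit_square)"
    "\<And>x y. \<lbrakk>x \<in> {0..1}; y \<in> {0..1}\<rbrakk> \<Longrightarrow> measure (copula_measure C) ({0..x} \<times> {0..y}) = C (x, y)"
    by auto
qed

section \<open>Layer-cake formulas\<close>

text \<open>Fubini's theorem for the indicator of \<open>S\<close> on the product with
  \<open>{a..b}\<close>. If the slice over \<open>p\<close> is an interval of length
  \<open>\<phi> p\<close>, the left-hand side is the integral of \<open>\<phi>\<close>; the
  right-hand side involves only masses of sets in \<open>M\<close>.\<close>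

lemma (in finite_measure) integral_measure_slices:
  fixes a b :: real
  assumes S: "S \<in> sets (M \<Otimes>\<^sub>M borel)"
  shows "(\<integral>p. measure lborel {t \<in> {a..b}. (p, t) \<in> S} \<partial>M) =
    set_lebesgue_integral lborel {a..b} (\<lambda>t. measure M {p \<in> space M. (p, t) \<in> S})"
proof -
  \<comment> \<open>Restricting to \<open>{a..b}\<close> makes the second factor finite, so that the
    bounded indicator is integrable on the product.\<close>
  define K where "K = restrict_space (lborel :: real measure) {a..b}"
  have K: "finite_measure K"
    by (rule finite_measureI) (simp add: K_def space_restrict_space emeasure_restrict_space emeasure_lborel_Icc_eq)
  interpret K: finite_measure K by (rule K)
  interpret pair_sigma_finite M K ..
  interpret MK: finite_measure "M \<Otimes>\<^sub>M K" by (rule finite_measure_pair_measure) unfold_locales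
  have "(\<lambda>t. t) \<in> measurable K borel" unfolding K_def by (rule measurable_restrict_space1) simp
  then have "(\<lambda>x. (fst x, snd x)) \<in> measurable (M \<Otimes>\<^sub>M K) (M \<Otimes>\<^sub>M borel)"
    by (intro measurable_Pair measurable_fst measurable_compose[OF measurable_snd])
  from measurable_sets[OF this S] have S': "S \<inter> space (M \<Otimes>\<^sub>M K) \<in> sets (M \<Otimes>\<^sub>M K)"
    by (simp only: prod.collapse vimage_ident)
  have sl1: "{p \<in> space M. (p, t) \<in> S} \<in> sets M" for t
    using sets_Pair2[OF S, of t] sets.sets_into_space[OF S] by (simp add: vimage_def space_pair_measure Collect_conj_eq) 
  have sl2: "{t \<in> {a..b}. (p, t) \<in> S} \<in> sets borel" for p
  proof -
    have "{t \<in> {a..b}. (p, t) \<in> S} = {a..b} \<inter> Pair p -` S" by auto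
    then show ?thesis using sets_Pair1[OF S, of p] by simp
  qed
  have int: "integrable (M \<Otimes>\<^sub>M K) (case_prod (\<lambda>p t. indicator S (p, t) :: real))"
  proof (rule MK.integrable_const_bound[where B = 1])
    have "(indicator (S \<inter> space (M \<Otimes>\<^sub>M K)) :: _ \<Rightarrow> real) \<in> borel_measurable (M \<Otimes>\<^sub>M K)"
      using S' by simp
    then show "(case_prod (\<lambda>p t. indicator S (p, t) :: real)) \<in> borel_measurable (M \<Otimes>\<^sub>M K)"
      by (rule measurable_cong[THEN iffD1, rotated]) (auto simp: indicator_def)
  qed (auto simp: indicator_def)
  have 1: "(\<integral>p. indicator S (p, t) \<partial>M) = measure M {p \<in> space M. (p, t) \<in> S}" for t
  proof -
    have "(\<integral>p. indicator S (p, t) \<partial>M) = (\<integral>p. indicator {p \<in> space M. (p, t) \<in> S} p \<partial>M :: real)"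
      by (intro Bochner_Integration.integral_cong) (auto simp: indicator_def)
    also have "\<dots> = measure M {p \<in> space M. (p, t) \<in> S}"
      using sl1[of t] by (simp add: Int_absorb2 subset_eq)
    finally show ?thesis .
  qed
  have 2: "(\<integral>t. indicator S (p, t) \<partial>K) = measure lborel {t \<in> {a..b}. (p, t) \<in> S}" for p
  proof -
    have "indicator {a..b} t *\<^sub>R indicator S (p, t) = (indicator {t \<in> {a..b}. (p, t) \<in> S} t :: real)" for t
      by (simp add: indicator_def)
    then have "(\<integral>t. indicator S (p, t) \<partial>K) = (\<integral>t. indicator {t \<in> {a..b}. (p, t) \<in> S} t \<partial>lborel :: real)"
      unfolding K_def by (subst integral_restrict_space) (simp_all only: space_borel space_lborel sets_lborel Int_UNIV_right atLeastAtMost_borel)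
    also have "\<dots> = measure lborel {t \<in> {a..b}. (p, t) \<in> S}"
      using sl2[of p] by simp
    finally show ?thesis .
  qed
  have "(\<integral>t. measure M {p \<in> space M. (p, t) \<in> S} \<partial>K) = (\<integral>p. measure lborel {t \<in> {a..b}. (p, t) \<in> S} \<partial>M)"
    using Fubini_integral[OF int] unfolding 1 2 .
  then show ?thesis
    unfolding K_def set_lebesgue_integral_def by (subst (asm) integral_restrict_space) auto
qed

section \<open>Masses of rectangles and quadrants under a copula\<close>

lemma copula_measure_rectangle:
  assumes "C \<in> copulas" "x \<in> {0..1}" "y \<in> {0..1}"
  shows "{0..x} \<times> {0..y} \<in> sets (copula_measure C)"
proof -
  have "{0..x} \<times> {0..y} \<in> sets borel" by (intro borel_closed closed_Times) auto
  then show ?thesis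
    unfolding copula_measure(2)[OF assms(1)] sets_restrict_space
    by (rule image_eqI[rotated]) (use assms in \<open>auto simp: unit_square_def\<close>)
qed

lemma space_copula_measure:
  assumes "C \<in> copulas"
  shows "space (copula_measure C) = unit_square"
  using sets_eq_imp_space_eq[OF copula_measure(2)[OF assms]] by (simp add: space_restrict_space)

text \<open>The complement is the union of a vertical and a horizontal strip, whose mass
  inclusion-exclusion gives.\<close>

lemma copula_measure_upper_right:
  assumes C: "C \<in> copulas" and x: "x \<in> {0..1}" and y: "y \<in> {0..1}"
  shows "measure (copula_measure C) {p \<in> unit_square. x < fst p \<and> y < snd p} = 1 - x - y + C (x, y)"
proof -
  let ?M = "copula_measure C"
  interpret prob_space ?M by (rule copula_measure(1)[OF C])
  have one: "(1::real) \<in> {0..1}" by simp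
  note R = copula_measure_rectangle[OF C]
  let ?A = "{0..x} \<times> {0..1::real}" and ?B = "{0..1::real} \<times> {0..y}"
  have "{p \<in> unit_square. x < fst p \<and> y < snd p} = space ?M - (?A \<union> ?B)"
    using x y by (auto simp: space_copula_measure[OF C] unit_square_def)
  then have "measure ?M {p \<in> unit_square. x < fst p \<and> y < snd p} = 1 - measure ?M (?A \<union> ?B)"
    using R[OF x one] R[OF one y] by (simp add: prob_compl)
  also have "measure ?M (?A \<union> ?B) = measure ?M ?A + measure ?M ?B - measure ?M (?A \<inter> ?B)"
    using R[OF x one] R[OF one y] by (intro measure_Un3) (auto simp: fmeasurable_eq_sets)
  also have "?A \<inter> ?B = {0..x} \<times> {0..y}" using x y by auto
  finally show ?thesis
    using copula_measure(3)[OF C] x y copulaD[OF C] by simp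
qed

lemma copula_measure_not_lower_left:
  assumes C: "C \<in> copulas" and x: "x \<in> {0..1}" and y: "y \<in> {0..1}"
  shows "measure (copula_measure C) {p \<in> unit_square. x < fst p \<or> y < snd p} = 1 - C (x, y)"
proof -
  let ?M = "copula_measure C"
  interpret prob_space ?M by (rule copula_measure(1)[OF C])
  have "{p \<in> unit_square. x < fst p \<or> y < snd p} = space ?M - {0..x} \<times> {0..y}"
    using x y by (auto simp: space_copula_measure[OF C] unit_square_def)
  then show ?thesis
    using copula_measure_rectangle[OF C x y] copula_measure(3)[OF C x y] by (simp add: prob_compl)
qed

text \<open>The sets to be sliced below are cut out by strict inequalities between continuous
  functions, so this settles their measurability.\<close>

lemma open_in_sets_pair_copula_measure:
  assumes C: "C \<in> copulas" and S: "open S"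
  shows "{q \<in> unit_square \<times> UNIV. q \<in> S} \<in> sets (copula_measure C \<Otimes>\<^sub>M (borel :: real measure))"
proof -
  have "(\<lambda>p. p) \<in> measurable (copula_measure C) borel"
    using measurable_restrict_space1[of "\<lambda>p. p" borel borel unit_square]
    by (simp add: measurable_cong_sets[OF copula_measure(2)[OF C] refl])
  then have "(\<lambda>q. (fst q, snd q)) \<in> measurable (copula_measure C \<Otimes>\<^sub>M (borel :: real measure)) (borel \<Otimes>\<^sub>M borel)"
    by measurable
  then have "(\<lambda>q. q) \<in> measurable (copula_measure C \<Otimes>\<^sub>M (borel :: real measure)) borel"
    by (simp add: borel_prod)
  from measurable_sets[OF this borel_open[OF S]] show ?thesis
    by (simp add: space_pair_measure space_copula_measure[OF C] vimage_def Collect_conj_eq Int_commute)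
qed

lemma continuous_on_copula_compose:
  assumes "C \<in> copulas" "continuous_on A f" "continuous_on A g" "f ` A \<subseteq> {0..1}" "g ` A \<subseteq> {0..1}"
  shows "continuous_on A (\<lambda>t. C (f t, g t))"
  by (rule continuous_on_compose2[OF continuous_on_copula[OF assms(1)]])
    (use assms in \<open>auto simp: unit_square_def intro!: continuous_on_Pair\<close>)

text \<open>The slice of \<open>S\<close> over \<open>p\<close> is an open interval from
  \<open>1 + a - snd p\<close> to \<open>fst p\<close>, which lies within \<open>{a..1}\<close> and
  has the excess as its length. The slice at level \<open>t\<close> is the quadrant beyond
  \<open>(t, 1 + a - t)\<close>; in its mass the linear terms add up to the constant
  \<open>- a\<close>.\<close>

lemma integral_upper_sum_excess:
  assumes C: "C \<in> copulas" and a: "a \<in> {0..1}"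
  shows "(\<integral>p. max 0 (fst p + snd p - 1 - a) \<partial>copula_measure C) =
    integral {a..1} (\<lambda>t. C (t, 1 + a - t) - a)"
proof -
  let ?M = "copula_measure C"
  interpret prob_space ?M by (rule copula_measure(1)[OF C])
  define S where "S = {q \<in> unit_square \<times> UNIV. q \<in> {q :: (real \<times> real) \<times> real. snd q < fst (fst q) \<and> 1 + a - snd q < snd (fst q)}}"
  have S: "S \<in> sets (?M \<Otimes>\<^sub>M borel)"
    unfolding S_def by (intro open_in_sets_pair_copula_measure C open_Collect_conj open_Collect_less continuous_intros)
  have "(\<integral>p. max 0 (fst p + snd p - 1 - a) \<partial>?M) = (\<integral>p. measure lborel {t \<in> {a..1}. (p, t) \<in> S} \<partial>?M)"
  proof (intro Bochner_Integration.integral_cong refl)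
    fix p assume "p \<in> space ?M"
    then have p: "p \<in> unit_square" by (simp add: space_copula_measure[OF C])
    then have eq: "{t \<in> {a..1}. (p, t) \<in> S} = {1 + a - snd p<..<fst p}"
      by (auto simp: S_def unit_square_def)
    then show "max 0 (fst p + snd p - 1 - a) = measure lborel {t \<in> {a..1}. (p, t) \<in> S}"
      unfolding eq by (cases "1 + a - snd p \<le> fst p") auto
  qed
  also have "\<dots> = set_lebesgue_integral lborel {a..1} (\<lambda>t. measure ?M {p \<in> space ?M. (p, t) \<in> S})"
    by (rule integral_measure_slices[OF S])
  also have "\<dots> = set_lebesgue_integral lborel {a..1} (\<lambda>t. C (t, 1 + a - t) - a)"
  proof (intro set_lebesgue_integral_cong ballI allI impI)
    fix t assume t: "t \<in> {a..1}"
    have "{p \<in> space ?M. (p, t) \<in> S} = {p \<in> unit_square. t < fst p \<and> 1 + a - t < snd p}"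
      by (auto simp: S_def space_copula_measure[OF C])
    then show "measure ?M {p \<in> space ?M. (p, t) \<in> S} = C (t, 1 + a - t) - a"
      using copula_measure_upper_right[OF C, of t "1 + a - t"] t a by simp
  qed simp
  also have "\<dots> = integral {a..1} (\<lambda>t. C (t, 1 + a - t) - a)"
    using a by (intro set_borel_integral_eq_integral borel_integrable_atLeastAtMost' continuous_on_diff
        continuous_on_copula_compose[OF C] continuous_intros) auto
  finally show ?thesis .
qed

text \<open>Here the slice over \<open>p\<close> runs from \<open>a\<close> to the larger
  coordinate, and the slice at level \<open>t\<close> is the complement of the square
  \<open>{0..t} \<times> {0..t}\<close>.\<close>

lemma integral_upper_max_excess:
  assumes C: "C \<in> copulas" and a: "a \<in> {0..1}"
  shows "(\<integral>p. max 0 (max (fst p) (snd p) - a) \<partial>copula_measure C) =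
    integral {a..1} (\<lambda>t. 1 - C (t, t))"
proof -
  let ?M = "copula_measure C"
  interpret prob_space ?M by (rule copula_measure(1)[OF C])
  define S where "S = {q \<in> unit_square \<times> UNIV. q \<in> {q :: (real \<times> real) \<times> real. snd q < fst (fst q) \<or> snd q < snd (fst q)}}"
  have S: "S \<in> sets (?M \<Otimes>\<^sub>M borel)"
    unfolding S_def by (intro open_in_sets_pair_copula_measure C open_Collect_disj open_Collect_less continuous_intros)
  have Ico: "measure lborel {a..<m} = max 0 (m - a)" for m
  proof (cases "a \<le> m")
    case False
    then have "{a..<m} = {}" by simp
    with False show ?thesis by (simp only: measure_empty)
  qed simp
  have "(\<integral>p. max 0 (max (fst p) (snd p) - a) \<partial>?M) = (\<integral>p. measure lborel {t \<in> {a..1}. (p, t) \<in> S} \<partial>?M)"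
  proof (intro Bochner_Integration.integral_cong refl)
    fix p assume "p \<in> space ?M"
    then have p: "p \<in> unit_square" by (simp add: space_copula_measure[OF C])
    then have eq: "{t \<in> {a..1}. (p, t) \<in> S} = {a..<max (fst p) (snd p)}"
      by (auto simp: S_def unit_square_def)
    then show "max 0 (max (fst p) (snd p) - a) = measure lborel {t \<in> {a..1}. (p, t) \<in> S}"
      using Ico unfolding eq by simp
  qed
  also have "\<dots> = set_lebesgue_integral lborel {a..1} (\<lambda>t. measure ?M {p \<in> space ?M. (p, t) \<in> S})"
    by (rule integral_measure_slices[OF S])
  also have "\<dots> = set_lebesgue_integral lborel {a..1} (\<lambda>t. 1 - C (t, t))"
  proof (intro set_lebesgue_integral_cong ballI allI impI)
    fix t assume t: "t \<in> {a..1}"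
    have "{p \<in> space ?M. (p, t) \<in> S} = {p \<in> unit_square. t < fst p \<or> t < snd p}"
      by (auto simp: S_def space_copula_measure[OF C])
    then show "measure ?M {p \<in> space ?M. (p, t) \<in> S} = 1 - C (t, t)"
      using copula_measure_not_lower_left[OF C, of t t] t a by simp
  qed simp
  also have "\<dots> = integral {a..1} (\<lambda>t. 1 - C (t, t))"
    using a by (intro set_borel_integral_eq_integral borel_integrable_atLeastAtMost' continuous_on_diff
        continuous_on_copula_compose[OF C] continuous_intros) auto
  finally show ?thesis .
qed

section \<open>Ordinal sums\<close>

lemma upper_sum_excess_icx: "(\<lambda>p. max 0 (fst p + snd p - c)) \<in> icx_functions"
proof -
  have "convex_on unit_square (\<lambda>p. max 0 (fst p + snd p - c))"
  proof (rule convex_onI)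
    fix t :: real and p q :: "real \<times> real" assume t: "0 < t" "t < 1"
    define u v where "u = fst p + snd p - c" and "v = fst q + snd q - c"
    have "(1 - t) * u + t * v \<le> (1 - t) * max 0 u + t * max 0 v"
      using t by (intro add_mono mult_left_mono; simp)
    moreover have "0 \<le> (1 - t) * max 0 u + t * max 0 v" using t by simp
    moreover have "fst ((1 - t) *\<^sub>R p + t *\<^sub>R q) + snd ((1 - t) *\<^sub>R p + t *\<^sub>R q) - c = (1 - t) * u + t * v"
      by (simp add: u_def v_def algebra_simps)
    ultimately show "max 0 (fst ((1 - t) *\<^sub>R p + t *\<^sub>R q) + snd ((1 - t) *\<^sub>R p + t *\<^sub>R q) - c)
        \<le> (1 - t) * max 0 (fst p + snd p - c) + t * max 0 (fst q + snd q - c)"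
      by (simp add: u_def v_def)
  qed (simp add: unit_square_def convex_Times)
  then show ?thesis by (auto simp: icx_functions_def mono_on_def)
qed

text \<open>The function is the maximum of the three increasing affine functions \<open>0\<close>,
  \<open>fst p - c\<close> and \<open>snd p - c\<close>.\<close>

lemma upper_max_excess_icx: "(\<lambda>p. max 0 (max (fst p) (snd p) - c)) \<in> icx_functions"
proof -
  have "convex_on unit_square (\<lambda>p. max 0 (max (fst p) (snd p) - c))"
  proof (rule convex_onI)
    fix t :: real and p q :: "real \<times> real" assume t: "0 < t" "t < 1"
    define u v where "u = max (fst p) (snd p) - c" and "v = max (fst q) (snd q) - c"
    have "(1 - t) * fst p + t * fst q \<le> (1 - t) * (u + c) + t * (v + c)"
      "(1 - t) * snd p + t * snd q \<le> (1 - t) * (u + c) + t * (v + c)"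
      using t by (intro add_mono mult_left_mono; simp add: u_def v_def)+
    then have "max (fst ((1 - t) *\<^sub>R p + t *\<^sub>R q)) (snd ((1 - t) *\<^sub>R p + t *\<^sub>R q)) - c \<le> (1 - t) * u + t * v"
      by (simp add: algebra_simps)
    moreover have "(1 - t) * u + t * v \<le> (1 - t) * max 0 u + t * max 0 v"
      using t by (intro add_mono mult_left_mono; simp)
    moreover have "0 \<le> (1 - t) * max 0 u + t * max 0 v" using t by simp
    ultimately show "max 0 (max (fst ((1 - t) *\<^sub>R p + t *\<^sub>R q)) (snd ((1 - t) *\<^sub>R p + t *\<^sub>R q)) - c)
        \<le> (1 - t) * max 0 (max (fst p) (snd p) - c) + t * max 0 (max (fst q) (snd q) - c)"
      unfolding u_def v_def by linarith
  qed (simp add: unit_square_def convex_Times)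
  then show ?thesis by (auto simp: icx_functions_def mono_on_def)
qed

section \<open>Extreme copulas and their insertion into a corner\<close>

text \<open>The Frechet-Hoeffding upper bound; the next definition is the lower bound.\<close>

definition comonotone_copula :: "real \<times> real \<Rightarrow> real" where
  "comonotone_copula = restrict (\<lambda>(x, y). min x y) unit_square"

definition countermonotone_copula :: "real \<times> real \<Rightarrow> real" where
  "countermonotone_copula = restrict (\<lambda>(x, y). max 0 (x + y - 1)) unit_square"

lemma comonotone_copula_in_copulas: "comonotone_copula \<in> copulas"
  by (rule copulaI) (auto simp: comonotone_copula_def unit_square_def min_def)

lemma countermonotone_copula_in_copulas: "countermonotone_copula \<in> copulas"
  by (rule copulaI) (auto simp: countermonotone_copula_def unit_square_def max_def)

text \<open>Mass \<open>a\<close> is distributed on the lower left block like \<open>A\<close>, and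
  mass \<open>1 - a\<close> on the upper right block like \<open>D\<close>. Clamping the rescaled
  coordinates lets one formula cover all four blocks: off its own block, each term takes boundary
  values.\<close>

definition ordinal_sum ::
  "real \<Rightarrow> (real \<times> real \<Rightarrow> real) \<Rightarrow> (real \<times> real \<Rightarrow> real) \<Rightarrow> real \<times> real \<Rightarrow> real" where
  "ordinal_sum a A D = restrict (\<lambda>(x, y). a * A (min (x / a) 1, min (y / a) 1) +
     (1 - a) * D (max ((x - a) / (1 - a)) 0, max ((y - a) / (1 - a)) 0)) unit_square"

context
  fixes a :: real and A D :: "real \<times> real \<Rightarrow> real"
  assumes a: "0 < a" "a < 1" and A: "A \<in> copulas" and D: "D \<in> copulas"
begin

text \<open>Each term is a copula composed with increasing coordinate maps, which preserves the
  rectangle inequality. The margins are right because the clamped coordinates, weighted by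
  \<open>a\<close> and \<open>1 - a\<close>, add up to \<open>x\<close>.\<close>

lemma ordinal_sum_in_copulas: "ordinal_sum a A D \<in> copulas"
proof -
  define p r where "p x = min (x / a) 1" and "r x = max ((x - a) / (1 - a)) 0" for x
  have p: "p x \<in> {0..1}" and r: "r x \<in> {0..1}" if "x \<in> {0..1}" for x
    using that a by (auto simp: p_def r_def field_simps min_def max_def)
  have p_mono: "p x \<le> p y" and r_mono: "r x \<le> r y" if "x \<le> y" for x y
    using that a divide_right_mono[of x y a] divide_right_mono[of "x - a" "y - a" "1 - a"]
    unfolding p_def r_def by (auto intro!: min.mono max.mono)
  have pr: "a * p x + (1 - a) * r x = x" for x
    using a by (cases "x \<le> a") (auto simp: p_def r_def min_def max_def field_simps)
  have ends: "p 0 = 0" "r 0 = 0" "p 1 = 1" "r 1 = 1"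
    using a by (auto simp: p_def r_def min_def max_def field_simps)
  have os: "ordinal_sum a A D (x, y) = a * A (p x, p y) + (1 - a) * D (r x, r y)"
    if "x \<in> {0..1}" "y \<in> {0..1}" for x y
    using that by (simp add: ordinal_sum_def unit_square_def p_def r_def)
  show ?thesis
  proof (rule copulaI)
    show "ordinal_sum a A D \<in> extensional unit_square" by (simp add: ordinal_sum_def)
    fix t :: real assume t: "t \<in> {0..1}"
    show "ordinal_sum a A D (t, 0) = 0" "ordinal_sum a A D (0, t) = 0"
      "ordinal_sum a A D (t, 1) = t" "ordinal_sum a A D (1, t) = t"
      using t p[OF t] r[OF t] pr[of t] copulaD[OF A p[OF t]] copulaD[OF D r[OF t]]
      by (simp_all add: os ends)
  next
    fix u u' v v' :: real
    assume uv: "0 \<le> u" "u \<le> u'" "u' \<le> 1" "0 \<le> v" "v \<le> v'" "v' \<le> 1"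
    let ?V = "\<lambda>C f. C (f u', f v') - C (f u, f v') - C (f u', f v) + C (f u, f v)"
    have "0 \<le> ?V A p" using uv by (intro copula_rectangle[OF A] p p_mono) auto
    moreover have "0 \<le> ?V D r" using uv by (intro copula_rectangle[OF D] r r_mono) auto
    ultimately have "0 \<le> a * ?V A p + (1 - a) * ?V D r" using a by simp
    then show "0 \<le> ordinal_sum a A D (u', v') - ordinal_sum a A D (u, v') - ordinal_sum a A D (u', v) + ordinal_sum a A D (u, v)"
      using uv by (simp add: os algebra_simps)
  qed
qed

text \<open>Rescaling moves each coordinate by at most \<open>1 - a\<close>, which costs
  \<open>2 * (1 - a)\<close> by the Lipschitz bound. Giving weight \<open>1 - a\<close> to
  \<open>D\<close> instead of \<open>A\<close> costs at most another \<open>1 - a\<close>.\<close>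

lemma ordinal_sum_dist: "copula_dist A (ordinal_sum a A D) \<le> 4 * (1 - a)"
proof (rule copula_dist_least[OF A ordinal_sum_in_copulas])
  fix q assume "q \<in> unit_square"
  then obtain x y where q: "q = (x, y)" "x \<in> {0..1}" "y \<in> {0..1}"
    unfolding unit_square_def by blast
  define p r where "p x = min (x / a) 1" and "r x = max ((x - a) / (1 - a)) 0" for x
  have p: "p x \<in> {0..1}" and r: "r x \<in> {0..1}" if "x \<in> {0..1}" for x
    using that a by (auto simp: p_def r_def field_simps min_def max_def)
  have p_near: "\<bar>p x - x\<bar> \<le> 1 - a" if "x \<in> {0..1}" for x
  proof (cases "x \<le> a")
    case True
    then have "p x = x / a" "x / a \<le> 1" using a by (auto simp: p_def)
    moreover have "x / a - x = (1 - a) * (x / a)" using a by (simp add: field_simps)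
    moreover have "(1 - a) * (x / a) \<le> 1 - a" "0 \<le> (1 - a) * (x / a)"
      using a that mult_left_mono[OF \<open>x / a \<le> 1\<close>, of "1 - a"] by simp_all
    ultimately show ?thesis by linarith
  next
    case False
    then show ?thesis using a that by (auto simp: p_def)
  qed
  have os: "ordinal_sum a A D q = a * A (p x, p y) + (1 - a) * D (r x, r y)"
    using q by (simp add: ordinal_sum_def unit_square_def p_def r_def)
  have "\<bar>A (p x, p y) - A q\<bar> \<le> 2 * (1 - a)"
    using order_trans[OF copula_Lipschitz[OF A q(2) p[OF q(2)] q(3) p[OF q(3)]]
        add_mono[OF p_near[OF q(2)] p_near[OF q(3)]]] unfolding q(1) by simp
  moreover have "A (p x, p y) \<in> {0..1}" "D (r x, r y) \<in> {0..1}"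
    using copula_range[OF A p p] copula_range[OF D r r] q by auto
  then have "\<bar>(1 - a) * (D (r x, r y) - A (p x, p y))\<bar> \<le> (1 - a) * 1"
    using a unfolding abs_mult by (intro mult_mono) auto
  moreover have "ordinal_sum a A D q = A (p x, p y) + (1 - a) * (D (r x, r y) - A (p x, p y))"
    by (simp add: os algebra_simps)
  ultimately show "\<bar>A q - ordinal_sum a A D q\<bar> \<le> 4 * (1 - a)"
    using a by linarith
qed

lemma ordinal_sum_upper:
  assumes "x \<in> {a..1}" "y \<in> {a..1}"
  shows "ordinal_sum a A D (x, y) = a + (1 - a) * D ((x - a) / (1 - a), (y - a) / (1 - a))"
  using assms a copulaD(4)[OF A, of 1]
  by (simp add: ordinal_sum_def unit_square_def min_absorb2 max_absorb1)

end

text \<open>The parabola \<open>(t - a) (1 - t) / (1 - a)\<close> stays below the tent \<open>min (t - a) (1 - t)\<close> and has an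
  elementary antiderivative.\<close>

lemma integral_tent_minorant:
  assumes "a < (1::real)"
  shows "((\<lambda>t. (t - a) * (1 - t) / (1 - a) - d) has_integral ((1 - a)\<^sup>2 / 6 - d * (1 - a))) {a..1}"
proof -
  \<comment> \<open>With \<open>s = t - a\<close>, the parabola is \<open>s - c * s^2\<close>, since
    \<open>1 - t = (1 - a) - s\<close>.\<close>
  define c F where "c = 1 / (1 - a)" and "F t = (t - a)\<^sup>2 / 2 - c * (t - a) ^ 3 / 3 - d * t" for t
  have c: "c * (1 - a) = 1" using assms by (simp add: c_def)
  have "((\<lambda>t. (t - a) - c * (t - a)\<^sup>2 - d) has_integral (F 1 - F a)) {a..1}"
    unfolding F_def
    by (rule fundamental_theorem_of_calculus)
      (use assms in \<open>auto simp: has_real_derivative_iff_has_vector_derivative[symmetric]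
        intro!: derivative_eq_intros\<close>)
  moreover have "(t - a) - c * (t - a)\<^sup>2 - d = (t - a) * (1 - t) / (1 - a) - d" for t
    using assms by (simp add: c_def field_simps power2_eq_square)
  moreover have "c * (1 - a) ^ 3 = (1 - a)\<^sup>2"
    using c by (simp add: power2_eq_square power3_eq_cube mult.assoc[symmetric])
  then have "F 1 - F a = (1 - a)\<^sup>2 / 6 - d * (1 - a)"
    by (simp add: F_def algebra_simps)
  ultimately show ?thesis by simp
qed

section \<open>Incomparable pairs\<close>

text \<open>The threshold \<open>(1 - a) / 6\<close> is the mean of the parabola over
  \<open>{a..1}\<close>, so a uniform loss \<open>d\<close> below it leaves the integral of the
  difference positive.\<close>

lemma integral_gt_of_tent:
  fixes f g :: "real \<Rightarrow> real"
  assumes a: "a < 1" and d: "d < (1 - a) / 6"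
    and f: "f integrable_on {a..1}" and g: "g integrable_on {a..1}"
    and le: "\<And>t. t \<in> {a..1} \<Longrightarrow> min (t - a) (1 - t) - d \<le> f t - g t"
  shows "integral {a..1} g < integral {a..1} f"
proof -
  have "0 < (1 - a) * ((1 - a) / 6 - d)" using a d by simp
  also have "\<dots> = (1 - a)\<^sup>2 / 6 - d * (1 - a)" by (simp add: field_simps power2_eq_square)
  also have "\<dots> \<le> integral {a..1} (\<lambda>t. f t - g t)"
  proof (rule has_integral_le[OF integral_tent_minorant[OF a] integrable_integral[OF integrable_diff[OF f g]]])
    fix t assume t: "t \<in> {a..1}"
    \<comment> \<open>Bounding one factor at a time by \<open>1 - a\<close> puts the parabola below
      both arms of the tent.\<close>
    have "(t - a) * (1 - t) \<le> (1 - a) * (1 - t)" "(t - a) * (1 - t) \<le> (t - a) * (1 - a)"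
      using t by (intro mult_right_mono mult_left_mono; simp)+
    then have "(t - a) * (1 - t) / (1 - a) \<le> min (t - a) (1 - t)"
      using a by (simp add: pos_divide_le_eq mult.commute)
    with le[OF t] show "(t - a) * (1 - t) / (1 - a) - d \<le> f t - g t" by linarith
  qed
  also have "\<dots> = integral {a..1} f - integral {a..1} g" by (rule integral_diff[OF f g])
  finally show ?thesis by simp
qed

text \<open>On the upper right block the two ordinal sums are \<open>min x y\<close> and
  \<open>max a (x + y - 1)\<close>. Each of \<open>A'\<close> and \<open>B'\<close> contributes an
  error below \<open>(1 - a) / 12\<close>, which together stay below the threshold
  \<open>(1 - a) / 6\<close> for the tent.\<close>

lemma icx_incomparable_near_ordinal_sums:
  assumes a: "0 < a" "a < 1" and A: "A \<in> copulas" and B: "B \<in> copulas"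
    and A': "A' \<in> copulas" "copula_dist (ordinal_sum a A comonotone_copula) A' < (1 - a) / 12"
    and B': "B' \<in> copulas" "copula_dist (ordinal_sum a B countermonotone_copula) B' < (1 - a) / 12"
  shows "\<not> icx_le A' B'" "\<not> icx_le B' A'"
proof -
  define \<delta> where "\<delta> = max (copula_dist (ordinal_sum a A comonotone_copula) A')
    (copula_dist (ordinal_sum a B countermonotone_copula) B')"
  have d: "2 * \<delta> < (1 - a) / 6" using A' B' by (simp add: \<delta>_def)
  have A_near: "\<bar>A' (x, y) - min x y\<bar> \<le> \<delta>" and B_near: "\<bar>B' (x, y) - max a (x + y - 1)\<bar> \<le> \<delta>"
    if xy: "x \<in> {a..1}" "y \<in> {a..1}" for x y
  proof -
    have sq: "(x, y) \<in> unit_square" "((x - a) / (1 - a), (y - a) / (1 - a)) \<in> unit_square"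
      using xy a by (auto simp: unit_square_def)
    have "ordinal_sum a A comonotone_copula (x, y) = min x y"
      unfolding ordinal_sum_upper[OF a A comonotone_copula_in_copulas xy] using a sq(2)
      by (auto simp: comonotone_copula_def min_def divide_le_cancel)
    then show "\<bar>A' (x, y) - min x y\<bar> \<le> \<delta>"
      using copula_dist_upper[OF ordinal_sum_in_copulas[OF a A comonotone_copula_in_copulas] A'(1) sq(1)]
      by (simp add: \<delta>_def)
    have "(1 - a) * ((x - a) / (1 - a) + (y - a) / (1 - a) - 1) = x + y - 1 - a"
      using a by (simp only: right_diff_distrib distrib_left) simp
    moreover have "(1 - a) * max 0 z = max 0 ((1 - a) * z)" for z
      using a by (auto simp: max_def mult_le_0_iff zero_le_mult_iff)
    ultimately have "ordinal_sum a B countermonotone_copula (x, y) = a + max 0 (x + y - 1 - a)"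
      unfolding ordinal_sum_upper[OF a B countermonotone_copula_in_copulas xy] using sq(2) by (simp add: countermonotone_copula_def)
    also have "\<dots> = max a (x + y - 1)" by simp
    finally show "\<bar>B' (x, y) - max a (x + y - 1)\<bar> \<le> \<delta>"
      using copula_dist_upper[OF ordinal_sum_in_copulas[OF a B countermonotone_copula_in_copulas] B'(1) sq(1)]
      by (simp add: \<delta>_def)
  qed
  have int: "(\<lambda>t. C (t, t)) integrable_on {a..1}" "(\<lambda>t. C (t, 1 + a - t)) integrable_on {a..1}"
    if "C \<in> copulas" for C
    using a that by (auto intro!: integrable_continuous_real continuous_on_copula_compose continuous_intros)
  have a01: "a \<in> {0..1}" using a by simp
  \<comment> \<open>Along the antidiagonal of the block, \<open>max a (x + y - 1)\<close> equals
    \<open>a\<close>, and \<open>min x y - a\<close> is the tent.\<close>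
  have "integral {a..1} (\<lambda>t. B' (t, 1 + a - t) - a) < integral {a..1} (\<lambda>t. A' (t, 1 + a - t) - a)"
  proof (rule integral_gt_of_tent[OF a(2) d])
    fix t assume t: "t \<in> {a..1}"
    then show "min (t - a) (1 - t) - 2 * \<delta> \<le> A' (t, 1 + a - t) - a - (B' (t, 1 + a - t) - a)"
      using A_near[of t "1 + a - t"] B_near[of t "1 + a - t"] by (auto simp: min_def abs_le_iff)
  qed (use A' B' int in \<open>auto intro!: integrable_diff\<close>)
  then show "\<not> icx_le A' B'"
    unfolding icx_le_def using upper_sum_excess_icx[of "1 + a"]
      integral_upper_sum_excess[OF A'(1) a01] integral_upper_sum_excess[OF B'(1) a01]
    by (force simp: diff_diff_eq)
  \<comment> \<open>Along the diagonal the same tent appears as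
    \<open>t - max a (2 * t - 1)\<close>; the minus sign before \<open>C (t, t)\<close> now favours
    \<open>B'\<close>.\<close>
  have "integral {a..1} (\<lambda>t. 1 - A' (t, t)) < integral {a..1} (\<lambda>t. 1 - B' (t, t))"
  proof (rule integral_gt_of_tent[OF a(2) d])
    fix t assume t: "t \<in> {a..1}"
    then show "min (t - a) (1 - t) - 2 * \<delta> \<le> 1 - B' (t, t) - (1 - A' (t, t))"
      using A_near[of t t] B_near[of t t] by (auto simp: min_def max_def abs_le_iff split: if_splits)
  qed (use A' B' int in \<open>auto intro!: integrable_diff\<close>)
  then show "\<not> icx_le B' A'"
    unfolding icx_le_def using upper_max_excess_icx[of a]
      integral_upper_max_excess[OF A'(1) a01] integral_upper_max_excess[OF B'(1) a01]
    by force
qed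

text \<open>A ball inside the closure would contain a pair of ordinal sums. Every neighbourhood of
  that pair would then meet the comparable pairs, but the ball of radius \<open>(1 - a) / 12\<close>
  around it contains none.\<close>

lemma nowhere_dense_icx_comparable_pairs:
  "nowhere_dense_in copula_pair_topology icx_comparable_pairs"
proof -
  interpret Metric_space "copulas \<times> copulas" copula_pair_dist
    by (rule Metric_space_copula_pairs)
  have False if P: "P \<in> copula_pair_topology interior_of (copula_pair_topology closure_of icx_comparable_pairs)" for P
  proof -
    obtain A B where P_eq: "P = (A, B)" by (cases P)
    from P obtain \<epsilon> where A: "A \<in> copulas" and B: "B \<in> copulas" and \<epsilon>: "0 < \<epsilon>"
      and ball: "mball (A, B) \<epsilon> \<subseteq> copula_pair_topology closure_of icx_comparable_pairs"
      unfolding metric_interior_of P_eq by auto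
    \<comment> \<open>The term \<open>\<epsilon> / 8\<close> keeps the displacement
      \<open>4 * (1 - a)\<close> at most \<open>\<epsilon> / 2\<close>, and \<open>1 / 2\<close>
      keeps \<open>a\<close> positive.\<close>
    define a where "a = 1 - min (1 / 2) (\<epsilon> / 8)"
    have a: "0 < a" "a < 1" "4 * (1 - a) < \<epsilon>" using \<epsilon> by (auto simp: a_def min_def)
    define A\<^sub>0 B\<^sub>0 where "A\<^sub>0 = ordinal_sum a A comonotone_copula"
      and "B\<^sub>0 = ordinal_sum a B countermonotone_copula"
    have AB0: "A\<^sub>0 \<in> copulas" "B\<^sub>0 \<in> copulas"
      unfolding A\<^sub>0_def B\<^sub>0_def using a A B comonotone_copula_in_copulas countermonotone_copula_in_copulas
      by (auto intro!: ordinal_sum_in_copulas)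
    have "copula_dist A A\<^sub>0 < \<epsilon>" "copula_dist B B\<^sub>0 < \<epsilon>"
      using ordinal_sum_dist[OF a(1,2) A comonotone_copula_in_copulas]
        ordinal_sum_dist[OF a(1,2) B countermonotone_copula_in_copulas] a(3)
      by (simp_all add: A\<^sub>0_def B\<^sub>0_def)
    then have "(A\<^sub>0, B\<^sub>0) \<in> mball (A, B) \<epsilon>"
      unfolding in_mball using A B AB0 by (simp add: copula_pair_dist_def)
    then have "(A\<^sub>0, B\<^sub>0) \<in> copula_pair_topology closure_of icx_comparable_pairs" using ball by blast
    moreover have "0 < (1 - a) / 12" using a by simp
    ultimately obtain Q where Q: "Q \<in> icx_comparable_pairs" "Q \<in> mball (A\<^sub>0, B\<^sub>0) ((1 - a) / 12)"
      unfolding metric_closure_of by blast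
    obtain A' B' where Q_eq: "Q = (A', B')" by (cases Q)
    have "copula_dist A\<^sub>0 A' < (1 - a) / 12" "copula_dist B\<^sub>0 B' < (1 - a) / 12"
      and "A' \<in> copulas" "B' \<in> copulas"
      using Q(2) unfolding in_mball Q_eq by (auto simp: copula_pair_dist_def)
    with icx_incomparable_near_ordinal_sums[OF a(1,2) A B, of A' B'] Q(1) show False
      by (simp add: A\<^sub>0_def B\<^sub>0_def Q_eq icx_comparable_pairs_def)
  qed
  then show ?thesis by (auto simp: nowhere_dense_in_def icx_comparable_pairs_def)
qed

text \<open>A nowhere dense set is meager as the union of the family whose only member is the set
  itself.\<close>

lemma comeager_in_complement:
  assumes "nowhere_dense_in X S"
  shows "comeager_in X (topspace X - S)"
proof -
  have "topspace X - (topspace X - S) = \<Union>{S}" using assms by (auto simp: nowhere_dense_in_def)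
  then have "meager_in X (topspace X - (topspace X - S))"
    unfolding meager_in_def using assms by (intro exI[of _ "{S}"]) simp
  then show ?thesis by (simp add: comeager_in_def)
qed

theorem theorem8:
  shows "nowhere_dense_in copula_pair_topology icx_comparable_pairs \<and>
    comeager_in copula_pair_topology (copulas \<times> copulas - icx_comparable_pairs)"
  using nowhere_dense_icx_comparable_pairs comeager_in_complement[OF nowhere_dense_icx_comparable_pairs]
  by (simp add: Metric_space.topspace_mtopology[OF Metric_space_copula_pairs])

end
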